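(* Let $w$ be a real-valued nondecreasing function of $x\ge1$ such that $w(x)\ge1$ for all $x\ge1$ and $\lim_{x\to\infty}w(x)=\infty$. Then there exists a subset $\Lambda$ of $\Gamma=\mathbb{Z}$ which is not a Sidon set and such that, for every pair $(h,k)$ of positive integers (i.e. $h,k\ge 1$) and every $k$-mesh $M\subset\mathbb{Z}$ of height $h$, $$|\Lambda\cap M|\le k\,w(kh).$$
   Context: $|S|$ denotes the cardinality of a set $S$. $\mathbb{Z}$ is regarded as the dual group of the circle group $\mathbb{T}=\mathbb{R}/2\pi\mathbb{Z}$, the integer $n$ corresponding to the character $t\mapsto e^{int}$. Sidon sets: for $S\ge1$, a subset $\Lambda\subset\mathbb{Z}$ is $S$-Sidon if for every trigonometric polynomial $P(t)=\sum_{n\in\Lambda}a_n e^{int}$ (finite sum, $a_n\in\mathbb{C}$) one has $\sum_{n}|a_n|\le S\,\sup_{t\in\mathbb{T}}|P(t)|$. $\Lambda$ is Sidon if it is $S$-Sidon for some $S\ge1$. For integers $k\ge1$, $h\ge1$, a $k$-mesh of height $h$ in $\mathbb{Z}$ is a set of the form $$M=\Big\{\sum_{j=1}^k n_j\gamma_j : (n_1,\dots,n_k)\in E\Big\},$$ where $\gamma_1,\dots,\gamma_k\in\mathbb{Z}$ and $E\subset\mathbb{Z}^k$ is a set such that $|n_j|\le h$ for all $j$ and all $(n_1,\dots,n_k)\in E$. *)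

theory Defs
  imports "HOL-Analysis.Analysis" "HOL-Library.FuncSet"
begin

definition trig_poly :: "int set \<Rightarrow> (int \<Rightarrow> complex) \<Rightarrow> real \<Rightarrow> complex" where
  "trig_poly F a t = (\<Sum>n\<in>F. a n * exp (\<i> * of_int n * of_real t))"

(* Functions on the circle group are treated as 2 pi-periodic functions of a real
   variable, so the supremum over the circle is a supremum over all real t; it is the
   supremum of a bounded set because F is finite. *)
definition S_Sidon :: "real \<Rightarrow> int set \<Rightarrow> bool" where
  "S_Sidon S \<Lambda> \<longleftrightarrow>
     (\<forall>F a. finite F \<and> F \<subseteq> \<Lambda> \<longrightarrow>
        (\<Sum>n\<in>F. norm (a n)) \<le> S * (SUP t. norm (trig_poly F a t)))"

definition Sidon :: "int set \<Rightarrow> bool" where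
  "Sidon \<Lambda> \<longleftrightarrow> (\<exists>S\<ge>1. S_Sidon S \<Lambda>)"

(* k-tuples of integers are extensional functions on the index set {1..k}. *)
definition is_mesh :: "nat \<Rightarrow> nat \<Rightarrow> int set \<Rightarrow> bool" where
  "is_mesh k h M \<longleftrightarrow>
     (\<exists>(\<gamma> :: nat \<Rightarrow> int) (E :: (nat \<Rightarrow> int) set).
        E \<subseteq> {1..k} \<rightarrow>\<^sub>E UNIV \<and>
        (\<forall>n\<in>E. \<forall>j\<in>{1..k}. \<bar>n j\<bar> \<le> int h) \<and>
        M = {\<Sum>j=1..k. n j * \<gamma> j | n. n \<in> E})"

(* Ensures that card of a subset of a mesh is its genuine cardinality. *)
lemma finite_mesh:
  assumes "is_mesh k h M"
  shows "finite M"
proof -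
  obtain \<gamma> :: "nat \<Rightarrow> int" and E where E: "E \<subseteq> {1..k} \<rightarrow>\<^sub>E (UNIV :: int set)"
    and h: "\<forall>n\<in>E. \<forall>j\<in>{1..k}. \<bar>n j\<bar> \<le> int h"
    and M: "M = {\<Sum>j=1..k. n j * \<gamma> j | n. n \<in> E}"
    using assms unfolding is_mesh_def by blast
  have "n \<in> {1..k} \<rightarrow>\<^sub>E {- int h..int h}" if "n \<in> E" for n
  proof (rule PiE_I)
    fix j assume "j \<in> {1..k}"
    with h that have "\<bar>n j\<bar> \<le> int h" by blast
    then show "n j \<in> {- int h..int h}" by auto
  next
    fix j assume "j \<notin> {1..k}"
    then show "n j = undefined" using E that by (meson PiE_arb subsetD)
  qed
  then have "E \<subseteq> {1..k} \<rightarrow>\<^sub>E {- int h..int h}" by blast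
  then have "finite E" by (rule finite_subset) (simp add: finite_PiE)
  moreover have "M = (\<lambda>n. \<Sum>j=1..k. n j * \<gamma> j) ` E" unfolding M by blast
  ultimately show ?thesis by simp
qed

end

theory Submission
  imports Defs
begin

text \<open>
  The set \<open>\<Lambda>\<close> is a union of finite blocks. Block \<open>j\<close> consists of the integers
  \<open>g a + g b\<close> for the edges \<open>ab\<close> of a bipartite graph that is a union of \<open>C j\<close> perfect matchings
  and has no cycle of length at most \<open>2 (X j + 1)\<close>; here \<open>g\<close> is so lacunary that relations with
  bounded coefficients must hold at each vertex separately. By Siegel's lemma, \<open>k + 1\<close>
  elements of a \<open>k\<close>-mesh of height \<open>h\<close> satisfy a nontrivial relation with coefficients
  bounded in terms of \<open>k\<close> and \<open>h\<close>, whereas matchings and small sets of edges, being forests,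
  admit none.
  So a \<open>k\<close>-mesh contains at most \<open>k\<close> elements of each matching, and at most \<open>k\<close> elements of
  all blocks with \<open>k h \<le> X j\<close> together. As \<open>X j\<close> may be chosen after the previous blocks, so
  large that \<open>w (X j)\<close> exceeds \<open>C j\<close> plus the number of their edges, the required bound follows.

  A block on \<open>2 n\<close> vertices has \<open>C n\<close> edges, so for random signs the exponential moment bound
  beats the \<open>4 ^ n\<close> sign patterns on the vertices once \<open>C\<close> is large: the sup norm
  of the signed exponential sum is a small multiple of \<open>C n\<close>. Hence the Sidon constants of the
  blocks are unbounded.

  The graphs are double covers of Cayley graphs: involutions \<open>s\<^sub>c\<close> acting on the reduced words
  of length at most \<open>r\<close> by adding or deleting the first letter \<open>c\<close> satisfy no relation
  of length at most \<open>r\<close>, since a reduced product moves the empty word.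
\<close>

section \<open>Involutions without short relations\<close>

text \<open>Words that already have the maximal length \<open>r\<close> and do not begin with
  \<open>c\<close> are left fixed; this truncation keeps the map an involution on reduced
  words.\<close>

definition toggle_letter :: "nat \<Rightarrow> nat \<Rightarrow> nat list \<Rightarrow> nat list" where
  "toggle_letter r c w =
     (if w \<noteq> [] \<and> hd w = c then tl w else if length w < r then c # w else w)"

definition reduced_words :: "nat \<Rightarrow> nat \<Rightarrow> nat list set" where
  "reduced_words C r = {w. set w \<subseteq> {..<C} \<and> length w \<le> r \<and> distinct_adj w}"

lemma finite_reduced_words: "finite (reduced_words C r)"
  by (rule finite_subset [OF _ finite_lists_length_le [of "{..<C}" r]])
     (auto simp: reduced_words_def)

lemma toggle_letter_in_reduced_words:
  assumes "c < C" "w \<in> reduced_words C r"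
  shows "toggle_letter r c w \<in> reduced_words C r"
  using assms
  by (cases w) (auto simp: toggle_letter_def reduced_words_def distinct_adj_Cons)

lemma toggle_letter_involution:
  assumes "w \<in> reduced_words C r"
  shows "toggle_letter r c (toggle_letter r c w) = w"
  using assms
  by (cases w) (auto simp: toggle_letter_def reduced_words_def distinct_adj_Cons)

text \<open>Neighbouring letters of \<open>cs\<close> differ, so no step deletes a letter, and the
  bound on the length means that no step is truncated: every letter is added in turn.\<close>

lemma fold_toggle_letter_Nil:
  assumes "distinct_adj cs" "length cs \<le> r"
  shows "fold (toggle_letter r) cs [] = rev cs"
  using assms
proof (induction cs rule: rev_induct)
  case (snoc c cs)
  then have "fold (toggle_letter r) cs [] = rev cs"
    by (auto simp: distinct_adj_append_iff)
  moreover have "cs \<noteq> [] \<Longrightarrow> last cs \<noteq> c"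
    using snoc.prems by (auto simp: distinct_adj_append_iff)
  then have "toggle_letter r c (rev cs) = c # rev cs"
    using snoc.prems by (auto simp: toggle_letter_def hd_rev)
  ultimately show ?case by simp
qed simp

text \<open>A short reduced product is only known to move the empty word, whereas every point has to
  be moved. So the involutions act by composition on the group \<open>G\<close> of all permutations
  of the words, numbered by \<open>h\<close>: a fixed point there would make the product the
  identity.\<close>

lemma free_involutions_exist:
  fixes C r :: nat
  obtains n :: nat and p :: "nat \<Rightarrow> nat \<Rightarrow> nat" where "n > 0"
    "\<And>c i. c < C \<Longrightarrow> i < n \<Longrightarrow> p c i < n"
    "\<And>c i. c < C \<Longrightarrow> i < n \<Longrightarrow> p c (p c i) = i"
    "\<And>cs i. set cs \<subseteq> {..<C} \<Longrightarrow> cs \<noteq> [] \<Longrightarrow> distinct_adj cs \<Longrightarrow> length cs \<le> r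
       \<Longrightarrow> i < n \<Longrightarrow> fold p cs i \<noteq> i"
proof -
  define W where "W = reduced_words C r"
  define G where "G = {f. f permutes W}"
  define s where "s = (\<lambda>c w. if w \<in> W then toggle_letter r c w else w)"
  have s_inv: "s c (s c w) = w" if "c < C" for c w
    using that toggle_letter_in_reduced_words [of c C w r] toggle_letter_involution [of w C r c]
    by (auto simp: s_def W_def)
  have sG: "s c \<in> G" if "c < C" for c
  proof -
    have "s c permutes W"
      unfolding permutes_def
    proof (intro conjI allI impI)
      show "\<exists>!x. s c x = y" for y
        using s_inv [OF that] by metis
    qed (auto simp: s_def)
    then show ?thesis by (simp add: G_def)
  qed
  have "finite G"
    unfolding G_def W_def by (intro finite_permutations finite_reduced_words)
  then obtain h where "bij_betw h G {0..<card G}"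
    using ex_bij_betw_finite_nat by blast
  then have h: "bij_betw h G {..<card G}" by (simp add: atLeast0LessThan)
  define n where "n = card G"
  define k where "k = inv_into G h"
  define p where "p = (\<lambda>c i. h (s c \<circ> k i))"
  have kG: "k i \<in> G" and hk: "h (k i) = i" if "i < n" for i
    using h that by (auto simp: k_def n_def bij_betw_def inv_into_into f_inv_into_f)
  have kh: "k (h f) = f" if "f \<in> G" for f
    using h that by (auto simp: k_def bij_betw_def)
  have hn: "h f < n" if "f \<in> G" for f
    using h that by (auto simp: n_def bij_betw_def)
  have compG: "s c \<circ> f \<in> G" if "c < C" "f \<in> G" for c f
    using sG [OF that(1)] that(2) by (simp add: G_def permutes_compose)
  have fold_s: "fold s cs f \<in> W \<and> fold s cs f = fold (toggle_letter r) cs f"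
    if "set cs \<subseteq> {..<C}" "f \<in> W" for cs f
    using that
  proof (induction cs arbitrary: f)
    case (Cons c cs)
    then have "s c f = toggle_letter r c f" "toggle_letter r c f \<in> W"
      by (simp_all add: s_def W_def toggle_letter_in_reduced_words)
    then show ?case using Cons by (metis fold_simps(2) insert_subset list.simps(15))
  qed simp
  have fold_p: "fold p cs i < n \<and> k (fold p cs i) = fold s cs \<circ> k i"
    if "set cs \<subseteq> {..<C}" "i < n" for cs i
    using that
  proof (induction cs arbitrary: i)
    case (Cons c cs)
    then have "s c \<circ> k i \<in> G" using compG kG by auto
    then have "p c i < n" "k (p c i) = s c \<circ> k i"
      by (simp_all add: p_def hn kh)
    then show ?case using Cons by (simp add: o_assoc comp_def)
  qed simp
  show thesis
  proof
    have "id \<in> G" by (simp add: G_def permutes_id)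
    then show "n > 0" using \<open>finite G\<close> by (auto simp: n_def card_gt_0_iff)
    show "p c i < n" if "c < C" "i < n" for c i
      using that by (simp add: p_def hn compG kG)
    show "p c (p c i) = i" if "c < C" "i < n" for c i
    proof -
      have "p c (p c i) = h (s c \<circ> (s c \<circ> k i))"
        using that by (simp add: p_def kh compG kG)
      also have "s c \<circ> (s c \<circ> k i) = k i"
        using s_inv [OF that(1)] by (simp add: fun_eq_iff)
      finally show ?thesis using hk that by simp
    qed
    show "fold p cs i \<noteq> i"
      if cs: "set cs \<subseteq> {..<C}" "cs \<noteq> []" "distinct_adj cs" "length cs \<le> r" and i: "i < n" for cs i
    proof
      assume "fold p cs i = i"
      with fold_p [OF cs(1) i] have eq: "fold s cs \<circ> k i = k i" by simp
      have "bij (k i)" using kG [OF i] by (simp add: G_def permutes_bij)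
      \<comment> \<open>The fixed point equation is evaluated at the preimage of the empty word
        under \<open>k i\<close>.\<close>
      then obtain u where u: "k i u = []" by (metis bij_pointE)
      have "fold s cs [] = []" using fun_cong [OF eq, of u] u by simp
      moreover have "fold s cs [] = rev cs"
        using fold_s [OF cs(1), of "[]"] cs by (simp add: W_def reduced_words_def fold_toggle_letter_Nil)
      ultimately show False using cs by simp
    qed
  qed
qed

section \<open>Relations on graphs without short cycles\<close>

text \<open>
  The hypotheses on \<open>m\<close> say that every vertex on which \<open>m\<close> does not vanish meets the support of
  \<open>m\<close> in at least two edges, so that one can walk in the support without ever turning back; a
  vertex visited twice yields a reduced word with a fixed point.
\<close>
lemma edge_relation_trivial:
  fixes m :: "nat \<Rightarrow> nat \<Rightarrow> int"
  assumes p_less: "\<And>c i. c < C \<Longrightarrow> i < n \<Longrightarrow> p c i < n"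
    and p_inv: "\<And>c i. c < C \<Longrightarrow> i < n \<Longrightarrow> p c (p c i) = i"
    and free: "\<And>cs i. set cs \<subseteq> {..<C} \<Longrightarrow> cs \<noteq> [] \<Longrightarrow> distinct_adj cs \<Longrightarrow> length cs \<le> r
       \<Longrightarrow> i < n \<Longrightarrow> fold p cs i \<noteq> i"
    and left: "\<And>i. i < n \<Longrightarrow> (\<Sum>c<C. m i c) = 0"
    and right: "\<And>i. i < n \<Longrightarrow> (\<Sum>c<C. m (p c i) c) = 0"
    and small: "2 * card {(i, c). i < n \<and> c < C \<and> m i c \<noteq> 0} \<le> r"
    and "i0 < n" "c0 < C"
  shows "m i0 c0 = 0"
proof (rule ccontr)
  assume nz: "m i0 c0 \<noteq> 0"
  define F where "F = {(i, c). i < n \<and> c < C \<and> m i c \<noteq> 0}"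
  have "finite F"
    by (rule finite_subset [of _ "{..<n} \<times> {..<C}"]) (auto simp: F_def)
  \<comment> \<open>The coefficient of the edge of colour \<open>c\<close> at the vertex
    \<open>i\<close> on side \<open>b\<close> (\<open>True\<close> is left). Since
    \<open>p c\<close> is an involution, the edge of colour \<open>c\<close> at the right vertex
    \<open>i\<close> starts at the left vertex \<open>p c i\<close>.\<close>
  define m' where "m' = (\<lambda>b i c. if b then m i c else m (p c i) c)"
  define ok where "ok = (\<lambda>(b, i, c). i < n \<and> c < C \<and> m' b i c \<noteq> 0)"
  have step: "\<exists>c'. c' \<noteq> c \<and> ok (\<not> b, p c i, c')" if "ok (b, i, c)" for b i c
  proof -
    have ic: "i < n" "c < C" "m' b i c \<noteq> 0" using that by (auto simp: ok_def)
    have pi: "p c i < n" using ic p_less by simp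
    have sum0: "(\<Sum>d<C. m' (\<not> b) (p c i) d) = 0"
      using left [OF pi] right [OF pi] by (cases b) (simp_all add: m'_def)
    have "m' (\<not> b) (p c i) c \<noteq> 0"
      using ic p_inv by (cases b) (simp_all add: m'_def)
    moreover have "(\<Sum>d<C. m' (\<not> b) (p c i) d)
        = m' (\<not> b) (p c i) c + (\<Sum>d\<in>{..<C} - {c}. m' (\<not> b) (p c i) d)"
      using ic by (simp add: sum.remove)
    ultimately have "(\<Sum>d\<in>{..<C} - {c}. m' (\<not> b) (p c i) d) \<noteq> 0" using sum0 by simp
    then obtain d where "d \<in> {..<C} - {c}" "m' (\<not> b) (p c i) d \<noteq> 0"
      by (meson sum.neutral)
    then show ?thesis using pi by (auto simp: ok_def)
  qed
  \<comment> \<open>The walk: each state holds a side, a vertex and the colour by which to leave it,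
    and the next colour differs from the one just used.\<close>
  have "\<exists>f. \<forall>x. ok (f x) \<and>
      (fst (snd (f (Suc x))) = p (snd (snd (f x))) (fst (snd (f x)))
        \<and> snd (snd (f (Suc x))) \<noteq> snd (snd (f x)))"
  proof (rule dependent_nat_choice)
    show "\<exists>x. ok x"
      using nz \<open>i0 < n\<close> \<open>c0 < C\<close> by (intro exI [of _ "(True, i0, c0)"]) (simp add: ok_def m'_def)
  next
    fix x :: "bool \<times> nat \<times> nat" and k :: nat
    assume "ok x"
    then show "\<exists>y. ok y \<and> fst (snd y) = p (snd (snd x)) (fst (snd x)) \<and> snd (snd y) \<noteq> snd (snd x)"
      using step by (cases x) fastforce
  qed
  then obtain f where f: "\<And>x. ok (f x)"
    and f_vertex: "\<And>x. fst (snd (f (Suc x))) = p (snd (snd (f x))) (fst (snd (f x)))"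
    and f_colour: "\<And>x. snd (snd (f (Suc x))) \<noteq> snd (snd (f x))" by blast
  define vertex where "vertex = (\<lambda>x. (fst (f x), fst (snd (f x))))"
  define V where "V = (\<lambda>(i, c). (True, i)) ` F \<union> (\<lambda>(i, c). (False, p c i)) ` F"
  have "vertex x \<in> V" for x
  proof (cases "f x")
    case (fields b i c)
    have ic: "i < n" "c < C" "m' b i c \<noteq> 0" using f [of x] fields by (auto simp: ok_def)
    show ?thesis
    proof (cases b)
      case True
      then have "(i, c) \<in> F" using ic by (simp add: F_def m'_def)
      then show ?thesis using True fields by (force simp: V_def vertex_def)
    next
      case False
      then have "(p c i, c) \<in> F" "p c (p c i) = i"
        using ic p_less p_inv by (simp_all add: F_def m'_def)
      then show ?thesis using False fields by (force simp: V_def vertex_def)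
    qed
  qed
  \<comment> \<open>\<open>V\<close> consists of the end points of the support, at most
    \<open>2 * card F\<close> of them, while the walk makes \<open>2 * card F + 1\<close>
    visits.\<close>
  then have "vertex ` {..2 * card F} \<subseteq> V" by blast
  moreover have "finite V" using \<open>finite F\<close> by (simp add: V_def)
  moreover have "card V \<le> 2 * card F"
    unfolding V_def mult_2
    by (rule order.trans [OF card_Un_le]) (intro add_mono card_image_le \<open>finite F\<close>)
  ultimately have "card (vertex ` {..2 * card F}) < card {..2 * card F}"
    by (metis card_atMost card_mono le_imp_less_Suc order.trans)
  then have "\<not> inj_on vertex {..2 * card F}" by (rule pigeonhole)
  then obtain x y where xy: "x < y" "y \<le> 2 * card F" "vertex x = vertex y"
    unfolding inj_on_def by (metis atMost_iff linorder_neqE_nat)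
  define cs where "cs = map (\<lambda>z. snd (snd (f z))) [x..<y]"
  have "fold p (map (\<lambda>z. snd (snd (f z))) [x..<x+d]) (fst (snd (f x))) = fst (snd (f (x+d)))" for d
    by (induction d) (simp_all add: f_vertex)
  from this [of "y - x"] have "fold p cs (fst (snd (f x))) = fst (snd (f x))"
    using xy by (simp add: cs_def vertex_def)
  moreover have "set cs \<subseteq> {..<C}"
  proof -
    have "snd (snd (f z)) < C" for z using f [of z] by (auto simp: ok_def split_beta)
    then show ?thesis by (auto simp: cs_def)
  qed
  moreover have "distinct_adj cs"
    unfolding distinct_adj_conv_nth cs_def using f_colour by (auto simp: eq_commute)
  moreover have "length cs \<le> r" using xy small by (simp add: cs_def F_def)
  moreover have "cs \<noteq> []" using xy by (simp add: cs_def)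
  moreover have "fst (snd (f x)) < n" using f [of x] by (auto simp: ok_def split_beta)
  ultimately show False using free by blast
qed

section \<open>Random signs and bilinear forms\<close>

text \<open>The exponential moment of a random sign. The exponent \<open>s\<^sup>2\<close> is not
  optimal but follows from elementary bounds: the terms linear in \<open>s\<close> cancel, leaving
  \<open>2 + 2 * s\<^sup>2\<close>.\<close>

lemma exp_plus_exp_minus_le:
  fixes s :: real
  assumes "0 \<le> s" "s \<le> 1"
  shows "exp s + exp (- s) \<le> 2 * exp (s\<^sup>2)"
proof -
  have "exp (- s) \<le> 1 / (1 + s)"
    using exp_ge_add_one_self [of s] assms by (simp add: exp_minus field_simps)
  also have "\<dots> \<le> 1 - s + s\<^sup>2"
    using assms by (simp add: divide_simps) (simp add: algebra_simps power2_eq_square)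
  finally show ?thesis
    using exp_bound [OF assms] exp_ge_add_one_self [of "s\<^sup>2"] by linarith
qed

text \<open>If each choice of \<open>\<epsilon>\<close> had a bad pair \<open>u\<close>,
  \<open>v\<close>, the exponential moments summed over all \<open>\<epsilon>\<close>,
  \<open>u\<close>, \<open>v\<close> would be large; but for fixed \<open>u\<close>,
  \<open>v\<close> the sum over \<open>\<epsilon>\<close> factors over the edges and is
  small.\<close>

lemma exists_signs_small_sign_form:
  fixes l :: "'e \<Rightarrow> 'a" and q :: "'e \<Rightarrow> 'b" and \<delta> :: real
  assumes fin: "finite E" "finite V" "finite W"
    and lV: "l ` E \<subseteq> V" and qW: "q ` E \<subseteq> W"
    and \<delta>: "0 < \<delta>" "\<delta> \<le> 1"
    and size: "real (card V + card W) * ln 2 < \<delta>\<^sup>2 / 4 * real (card E)"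
  shows "\<exists>\<epsilon> :: 'e \<Rightarrow> real. (\<forall>e\<in>E. \<epsilon> e \<in> {-1, 1}) \<and>
    (\<forall>u v. range u \<subseteq> {-1, 1} \<longrightarrow> range v \<subseteq> {-1, 1} \<longrightarrow>
       (\<Sum>e\<in>E. \<epsilon> e * u (l e) * v (q e)) \<le> \<delta> * card E)"
proof (rule ccontr)
  assume contr: "\<not> ?thesis"
  define Sg where "Sg = {-1, 1 :: real}"
  define B where "B = (\<lambda>(\<epsilon> :: 'e \<Rightarrow> real) (u, v). \<Sum>e\<in>E. \<epsilon> e * u (l e) * v (q e))"
  \<comment> \<open>This value maximises \<open>s * \<delta> - s\<^sup>2\<close>; the maximum
    \<open>\<delta>\<^sup>2 / 4\<close> is the constant in \<open>size\<close>.\<close>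
  define s where "s = \<delta> / 2"
  define N where "N = card E"
  define EE where "EE = (E \<rightarrow>\<^sub>E Sg)"
  define UV where "UV = (V \<rightarrow>\<^sub>E Sg) \<times> (W \<rightarrow>\<^sub>E Sg)"
  have Sg: "finite Sg" "card Sg = 2" by (simp_all add: Sg_def)
  have finUV: "finite UV" using fin Sg by (simp add: UV_def finite_PiE)
  have cardUV: "real (card UV) = 2 ^ (card V + card W)"
    using fin Sg by (simp add: UV_def card_cartesian_product card_PiE power_add)
  have cardEE: "real (card EE) = 2 ^ N"
    using fin Sg by (simp add: EE_def card_PiE N_def)
  have big: "exp (s * (\<delta> * N)) \<le> (\<Sum>uv\<in>UV. exp (s * B \<epsilon> uv))" if "\<epsilon> \<in> EE" for \<epsilon>
  proof -
    have "\<forall>e\<in>E. \<epsilon> e \<in> {-1, 1}" using that by (auto simp: EE_def Sg_def)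
    then obtain u v where uv: "range u \<subseteq> {-1, 1}" "range v \<subseteq> {-1, 1}"
      and gt: "\<delta> * N < (\<Sum>e\<in>E. \<epsilon> e * u (l e) * v (q e))"
      using contr unfolding N_def by (meson not_le)
    define uv' where "uv' = (restrict u V, restrict v W)"
    have "uv' \<in> UV" using uv by (auto simp: uv'_def UV_def Sg_def)
    have "B \<epsilon> uv' = (\<Sum>e\<in>E. \<epsilon> e * u (l e) * v (q e))"
      unfolding B_def uv'_def prod.case using lV qW by (intro sum.cong) auto
    then have "exp (s * (\<delta> * N)) \<le> exp (s * B \<epsilon> uv')"
      using gt \<delta> by (simp add: s_def)
    also have "\<dots> \<le> (\<Sum>uv\<in>UV. exp (s * B \<epsilon> uv))"
      using \<open>uv' \<in> UV\<close> finUV by (intro member_le_sum) auto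
    finally show ?thesis .
  qed
  have small: "(\<Sum>\<epsilon>\<in>EE. exp (s * B \<epsilon> uv)) \<le> (2 * exp (s\<^sup>2)) ^ N" if "uv \<in> UV" for uv
  proof -
    obtain u v where uv: "uv = (u, v)" by (cases uv)
    define \<omega> where "\<omega> = (\<lambda>e. u (l e) * v (q e))"
    have \<omega>: "\<omega> e \<in> {-1, 1}" if "e \<in> E" for e
    proof -
      have "u (l e) \<in> Sg" "v (q e) \<in> Sg"
        using \<open>uv \<in> UV\<close> lV qW that uv by (auto simp: UV_def)
      then show ?thesis by (auto simp: \<omega>_def Sg_def)
    qed
    have "(\<Sum>\<epsilon>\<in>EE. exp (s * B \<epsilon> uv)) = (\<Sum>\<epsilon>\<in>EE. \<Prod>e\<in>E. exp (s * \<epsilon> e * \<omega> e))"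
      using fin by (intro sum.cong)
        (auto simp: B_def uv \<omega>_def sum_distrib_left mult.assoc simp flip: exp_sum)
    also have "\<dots> = (\<Prod>e\<in>E. \<Sum>y\<in>Sg. exp (s * y * \<omega> e))"
      unfolding EE_def using fin Sg by (intro prod_sum_PiE [symmetric]) auto
    also have "\<dots> = (\<Prod>e\<in>E. exp s + exp (- s))"
    proof (intro prod.cong refl)
      fix e assume "e \<in> E"
      then show "(\<Sum>y\<in>Sg. exp (s * y * \<omega> e)) = exp s + exp (- s)"
        using \<omega> [of e] by (auto simp: Sg_def)
    qed
    also have "\<dots> = (exp s + exp (- s)) ^ N" by (simp add: N_def)
    also have "\<dots> \<le> (2 * exp (s\<^sup>2)) ^ N"
      using \<delta> by (intro power_mono exp_plus_exp_minus_le) (auto simp: s_def intro: add_nonneg_nonneg)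
    finally show ?thesis .
  qed
  have "2 ^ N * exp (s * (\<delta> * N)) = (\<Sum>\<epsilon>\<in>EE. exp (s * (\<delta> * N)))"
    by (simp add: cardEE)
  also have "\<dots> \<le> (\<Sum>\<epsilon>\<in>EE. \<Sum>uv\<in>UV. exp (s * B \<epsilon> uv))"
    by (intro sum_mono big)
  also have "\<dots> = (\<Sum>uv\<in>UV. \<Sum>\<epsilon>\<in>EE. exp (s * B \<epsilon> uv))"
    by (rule sum.swap)
  also have "\<dots> \<le> (\<Sum>uv\<in>UV. (2 * exp (s\<^sup>2)) ^ N)"
    by (intro sum_mono small)
  also have "\<dots> = 2 ^ N * (2 ^ (card V + card W) * exp (s\<^sup>2 * N))"
    by (simp add: cardUV power_mult_distrib exp_of_nat2_mult)
  finally have "exp (s * (\<delta> * N)) \<le> 2 ^ (card V + card W) * exp (s\<^sup>2 * N)"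
    by simp
  also have "\<dots> = exp (real (card V + card W) * ln 2 + s\<^sup>2 * N)"
    by (simp add: exp_add exp_of_nat_mult del: of_nat_add)
  finally have "s * (\<delta> * N) \<le> real (card V + card W) * ln 2 + s\<^sup>2 * N" by simp
  moreover have "s * (\<delta> * N) = \<delta>\<^sup>2 / 4 * N + s\<^sup>2 * N"
    by (simp add: s_def power2_eq_square algebra_simps)
  ultimately show False using size by (simp add: N_def)
qed

text \<open>The form is linear in each argument, so real arguments bounded by 1 can be replaced by
  signs. Splitting into real and imaginary parts costs the factor 2.\<close>

lemma exists_signs_small_bilinear_form:
  fixes l :: "'e \<Rightarrow> 'a" and q :: "'e \<Rightarrow> 'b" and \<delta> :: real
  assumes fin: "finite E" "finite V" "finite W"
    and lV: "l ` E \<subseteq> V" and qW: "q ` E \<subseteq> W"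
    and \<delta>: "0 < \<delta>" "\<delta> \<le> 1"
    and size: "real (card V + card W) * ln 2 < \<delta>\<^sup>2 / 4 * real (card E)"
  shows "\<exists>\<epsilon> :: 'e \<Rightarrow> real. (\<forall>e\<in>E. \<bar>\<epsilon> e\<bar> = (1 :: real)) \<and>
    (\<forall>(x :: 'a \<Rightarrow> complex) (y :: 'b \<Rightarrow> complex). (\<forall>a. cmod (x a) \<le> 1) \<longrightarrow> (\<forall>b. cmod (y b) \<le> 1) \<longrightarrow>
       cmod (\<Sum>e\<in>E. \<epsilon> e * x (l e) * y (q e)) \<le> 2 * \<delta> * card E)"
proof -
  obtain \<epsilon> :: "'e \<Rightarrow> real" where signs: "\<forall>e\<in>E. \<epsilon> e \<in> {-1, 1}"
    and sign_form: "\<And>u v. range u \<subseteq> {-1, 1} \<Longrightarrow> range v \<subseteq> {-1, 1} \<Longrightarrow>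
       (\<Sum>e\<in>E. \<epsilon> e * u (l e) * v (q e)) \<le> \<delta> * card E"
    using exists_signs_small_sign_form [OF assms] by blast
  \<comment> \<open>The value at 0 is 1, since \<open>sign_form\<close> admits only the values -1
    and 1.\<close>
  define sg where "sg = (\<lambda>t :: real. if t \<ge> 0 then 1 else - 1 :: real)"
  have sg: "sg t \<in> {-1, 1}" "sg t * t = \<bar>t\<bar>" for t by (auto simp: sg_def)
  have half_form: "(\<Sum>e\<in>E. \<epsilon> e * u (l e) * b (q e)) \<le> \<delta> * card E"
    if u: "range u \<subseteq> {-1, 1}" and b: "\<And>w. \<bar>b w\<bar> \<le> 1" for u b
  proof -
    define G where "G = (\<lambda>w. \<Sum>e | e \<in> E \<and> q e = w. \<epsilon> e * u (l e))"
    have expand: "(\<Sum>e\<in>E. \<epsilon> e * u (l e) * c (q e)) = (\<Sum>w\<in>W. c w * G w)" for c :: "'b \<Rightarrow> real"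
      unfolding sum.group [OF fin(1,3) qW, of "\<lambda>e. \<epsilon> e * u (l e) * c (q e)", symmetric] G_def
      by (auto simp: sum_distrib_left mult_ac intro!: sum.cong)
    have "(\<Sum>e\<in>E. \<epsilon> e * u (l e) * b (q e)) \<le> (\<Sum>w\<in>W. \<bar>G w\<bar>)"
      unfolding expand
    proof (rule sum_mono)
      fix w
      have "b w * G w \<le> \<bar>b w\<bar> * \<bar>G w\<bar>" by (simp add: abs_mult [symmetric])
      also have "\<dots> \<le> \<bar>G w\<bar>" using b [of w] by (simp add: mult_left_le_one_le)
      finally show "b w * G w \<le> \<bar>G w\<bar>" .
    qed
    also have "\<dots> = (\<Sum>e\<in>E. \<epsilon> e * u (l e) * sg (G (q e)))"
      by (simp add: expand [of "\<lambda>w. sg (G w)"] sg)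
    also have "\<dots> \<le> \<delta> * card E"
      using sign_form [OF u, of "\<lambda>w. sg (G w)"] sg by blast
    finally show ?thesis .
  qed
  have "cmod (\<Sum>e\<in>E. \<epsilon> e * x (l e) * y (q e)) \<le> 2 * \<delta> * card E"
    if x: "\<And>a. cmod (x a) \<le> 1" and y: "\<And>b. cmod (y b) \<le> 1"
    for x :: "'a \<Rightarrow> complex" and y :: "'b \<Rightarrow> complex"
  proof -
    have expand: "(\<Sum>a\<in>V. c a * (\<Sum>e | e \<in> E \<and> l e = a. \<epsilon> e * b (q e)))
        = (\<Sum>e\<in>E. \<epsilon> e * c (l e) * b (q e))" for c :: "'a \<Rightarrow> real" and b
      unfolding sum.group [OF fin(1,2) lV, of "\<lambda>e. \<epsilon> e * c (l e) * b (q e)", symmetric]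
      by (auto simp: sum_distrib_left mult_ac intro!: sum.cong)
    define H where "H = (\<lambda>a. \<Sum>e | e \<in> E \<and> l e = a. \<epsilon> e * y (q e))"
    have "(\<Sum>e\<in>E. \<epsilon> e * x (l e) * y (q e)) = (\<Sum>a\<in>V. x a * H a)"
      unfolding sum.group [OF fin(1,2) lV, of "\<lambda>e. \<epsilon> e * x (l e) * y (q e)", symmetric] H_def
      by (auto simp: sum_distrib_left mult_ac intro!: sum.cong)
    then have "cmod (\<Sum>e\<in>E. \<epsilon> e * x (l e) * y (q e)) \<le> (\<Sum>a\<in>V. cmod (x a * H a))"
      by (simp only: norm_sum)
    also have "\<dots> \<le> (\<Sum>a\<in>V. \<bar>Re (H a)\<bar> + \<bar>Im (H a)\<bar>)"
    proof (rule sum_mono)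
      fix a
      have "cmod (x a * H a) \<le> cmod (H a)"
        using x [of a] by (simp add: norm_mult mult_left_le_one_le)
      also have "\<dots> \<le> \<bar>Re (H a)\<bar> + \<bar>Im (H a)\<bar>" by (rule cmod_le)
      finally show "cmod (x a * H a) \<le> \<bar>Re (H a)\<bar> + \<bar>Im (H a)\<bar>" .
    qed
    also have "\<dots> = (\<Sum>a\<in>V. sg (Re (H a)) * Re (H a)) + (\<Sum>a\<in>V. sg (Im (H a)) * Im (H a))"
      by (simp add: sg sum.distrib)
    also have "(\<Sum>a\<in>V. sg (Re (H a)) * Re (H a)) \<le> \<delta> * card E"
    proof -
      have "(\<Sum>a\<in>V. sg (Re (H a)) * Re (H a)) = (\<Sum>e\<in>E. \<epsilon> e * sg (Re (H (l e))) * Re (y (q e)))"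
        using expand [of "\<lambda>a. sg (Re (H a))" "\<lambda>b. Re (y b)"] by (simp add: H_def)
      also have "\<dots> \<le> \<delta> * card E"
        using sg order.trans [OF abs_Re_le_cmod y] by (intro half_form [of "\<lambda>a. sg (Re (H a))"]) auto
      finally show ?thesis .
    qed
    also have "(\<Sum>a\<in>V. sg (Im (H a)) * Im (H a)) \<le> \<delta> * card E"
    proof -
      have "(\<Sum>a\<in>V. sg (Im (H a)) * Im (H a)) = (\<Sum>e\<in>E. \<epsilon> e * sg (Im (H (l e))) * Im (y (q e)))"
        using expand [of "\<lambda>a. sg (Im (H a))" "\<lambda>b. Im (y b)"] by (simp add: H_def)
      also have "\<dots> \<le> \<delta> * card E"
        using sg order.trans [OF abs_Im_le_cmod y] by (intro half_form [of "\<lambda>a. sg (Im (H a))"]) auto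
      finally show ?thesis .
    qed
    finally show ?thesis by simp
  qed
  then show ?thesis using signs by (intro exI [of _ \<epsilon>]) auto
qed

section \<open>Lacunary sequences and relations in meshes\<close>

text \<open>The term with the largest index among the nonzero coefficients would exceed the sum of
  all others in absolute value.\<close>

lemma lacunary_relation_trivial:
  fixes g z :: "nat \<Rightarrow> int" and \<tau> :: "nat \<Rightarrow> int"
  assumes lac: "\<And>v. \<tau> v * (\<Sum>u<v. g u) < g v" and pos: "\<And>v. 0 < g v"
    and "finite V" and bound: "\<And>u v. u \<in> V \<Longrightarrow> v \<in> V \<Longrightarrow> \<bar>z u\<bar> \<le> \<tau> v"
    and rel: "(\<Sum>v\<in>V. z v * g v) = 0" and "v \<in> V"
  shows "z v = 0"
proof (rule ccontr)
  assume "z v \<noteq> 0"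
  define Z where "Z = {u \<in> V. z u \<noteq> 0}"
  define x where "x = Max Z"
  have Z: "finite Z" "Z \<noteq> {}" using \<open>finite V\<close> \<open>v \<in> V\<close> \<open>z v \<noteq> 0\<close> by (auto simp: Z_def)
  then have "x \<in> Z" unfolding x_def by (rule Max_in)
  then have x: "x \<in> V" "z x \<noteq> 0" by (simp_all add: Z_def)
  have less: "u < x" if "u \<in> Z - {x}" for u
    using Max_ge [OF Z(1)] that by (auto simp: x_def order.strict_iff_order)
  have "(\<Sum>u\<in>Z. z u * g u) = 0"
    using rel \<open>finite V\<close> by (subst sum.mono_neutral_left [of V]) (auto simp: Z_def)
  then have "z x * g x = - (\<Sum>u\<in>Z - {x}. z u * g u)"
    using Z \<open>x \<in> Z\<close> by (simp add: sum.remove)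
  then have "\<bar>z x * g x\<bar> \<le> (\<Sum>u\<in>Z - {x}. \<bar>z u * g u\<bar>)" by simp
  also have "\<dots> \<le> (\<Sum>u\<in>Z - {x}. \<tau> x * g u)"
  proof (rule sum_mono)
    fix u assume "u \<in> Z - {x}"
    then show "\<bar>z u * g u\<bar> \<le> \<tau> x * g u"
      using bound [of u x] x(1) pos [of u] by (auto simp: abs_mult Z_def)
  qed
  also have "\<dots> \<le> (\<Sum>u<x. \<tau> x * g u)"
  proof (rule sum_mono2)
    show "Z - {x} \<subseteq> {..<x}" using less by blast
    have "0 \<le> \<tau> x" using bound [OF x(1) x(1)] by linarith
    then show "0 \<le> \<tau> x * g u" for u using pos [of u] by simp
  qed simp
  also have "\<dots> < g x" using lac [of x] by (simp add: sum_distrib_left)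
  also have "\<dots> \<le> \<bar>z x * g x\<bar>"
    using x(2) pos [of x] by (simp add: abs_mult)
  finally show False by simp
qed

text \<open>Siegel's lemma by the pigeonhole principle: two different coefficient vectors with
  entries in \<open>{0..int Q}\<close> give the same vector in the coordinates of the mesh, and
  their difference is the relation.\<close>

lemma mesh_relation:
  assumes mesh: "is_mesh k h M" and "h \<ge> 1" and "F \<subseteq> M" and card: "card F = Suc k"
  obtains m :: "int \<Rightarrow> int" where "\<exists>f\<in>F. m f \<noteq> 0"
    "\<And>f. f \<in> F \<Longrightarrow> \<bar>m f\<bar> \<le> int ((2 * Suc k * h) ^ k)" "(\<Sum>f\<in>F. m f * f) = 0"
proof -
  have "finite F" using card card_ge_0_finite by force
  obtain \<gamma> :: "nat \<Rightarrow> int" and E where h: "\<forall>n\<in>E. \<forall>j\<in>{1..k}. \<bar>n j\<bar> \<le> int h"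
    and M: "M = {\<Sum>j=1..k. n j * \<gamma> j | n. n \<in> E}"
    using mesh unfolding is_mesh_def by blast
  have "\<forall>f\<in>F. \<exists>n. n \<in> E \<and> f = (\<Sum>j=1..k. n j * \<gamma> j)" using \<open>F \<subseteq> M\<close> M by blast
  then obtain \<nu> where \<nu>: "\<And>f. f \<in> F \<Longrightarrow> \<nu> f \<in> E"
    "\<And>f. f \<in> F \<Longrightarrow> f = (\<Sum>j=1..k. \<nu> f j * \<gamma> j)" by metis
  \<comment> \<open>With this \<open>Q\<close>, the box of possible images has at most
    \<open>Q * Suc Q ^ k\<close> points, fewer than the \<open>Suc Q ^ Suc k\<close> coefficient
    vectors.\<close>
  define Q where "Q = (2 * Suc k * h) ^ k"
  define R where "R = Suc k * h * Q"
  define \<phi> where "\<phi> = (\<lambda>m :: int \<Rightarrow> int. \<lambda>j\<in>{1..k}. \<Sum>f\<in>F. m f * \<nu> f j)"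
  define A where "A = (F \<rightarrow>\<^sub>E {0..int Q})"
  define B where "B = ({1..k} \<rightarrow>\<^sub>E {- int R..int R})"
  have "\<phi> m \<in> B" if "m \<in> A" for m
    unfolding B_def \<phi>_def
  proof (intro restrict_PiE_iff [THEN iffD2] ballI)
    fix j assume j: "j \<in> {1..k}"
    have "\<bar>\<Sum>f\<in>F. m f * \<nu> f j\<bar> \<le> (\<Sum>f\<in>F. \<bar>m f * \<nu> f j\<bar>)" by (rule sum_abs)
    also have "\<dots> \<le> (\<Sum>f\<in>F. int Q * int h)"
    proof (rule sum_mono)
      fix f assume "f \<in> F"
      then have "\<bar>m f\<bar> \<le> int Q" using that by (auto simp: A_def PiE_def Pi_def)
      moreover have "\<bar>\<nu> f j\<bar> \<le> int h" using h \<nu>(1) \<open>f \<in> F\<close> j by blast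
      ultimately show "\<bar>m f * \<nu> f j\<bar> \<le> int Q * int h"
        unfolding abs_mult by (intro mult_mono) auto
    qed
    also have "\<dots> = int R" by (simp add: card R_def algebra_simps)
    finally show "(\<Sum>f\<in>F. m f * \<nu> f j) \<in> {- int R..int R}" by (simp add: abs_le_iff)
  qed
  then have "card (\<phi> ` A) \<le> card B"
    by (intro card_mono) (auto simp: B_def finite_PiE)
  also have "card B = (2 * R + 1) ^ k"
  proof -
    have "card {- int R..int R} = 2 * R + 1" by (simp add: nat_eq_iff)
    then show ?thesis by (simp add: B_def card_PiE)
  qed
  also have "\<dots> \<le> (2 * Suc k * h * Suc Q) ^ k"
  proof (rule power_mono)
    have "1 \<le> 2 * Suc k * h" using \<open>h \<ge> 1\<close> by simp
    then show "2 * R + 1 \<le> 2 * Suc k * h * Suc Q"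
      by (simp only: R_def mult_Suc_right mult.assoc) simp
  qed simp
  also have "\<dots> = Q * Suc Q ^ k"
    unfolding Q_def by (rule power_mult_distrib)
  also have "\<dots> < Suc Q ^ Suc k" by simp
  also have "\<dots> = card A"
  proof -
    have "card {0..int Q} = Suc Q" by (simp add: nat_eq_iff)
    then show ?thesis using \<open>finite F\<close> card by (simp add: A_def card_PiE)
  qed
  finally have "\<not> inj_on \<phi> A" by (rule pigeonhole)
  then obtain a b where ab: "a \<in> A" "b \<in> A" "a \<noteq> b" "\<phi> a = \<phi> b"
    unfolding inj_on_def by blast
  show thesis
  proof
    show "\<exists>f\<in>F. a f - b f \<noteq> 0"
    proof (rule ccontr)
      assume "\<not> ?thesis"
      then have "a f = b f" if "f \<in> F" for f using that by auto
      then have "a = b" using ab(1,2) unfolding A_def by (rule PiE_ext [rotated 2])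
      then show False using ab(3) by contradiction
    qed
    show "\<bar>a f - b f\<bar> \<le> int ((2 * Suc k * h) ^ k)" if "f \<in> F" for f
    proof -
      have "a f \<in> {0..int Q}" "b f \<in> {0..int Q}" using ab that by (auto simp: A_def)
      then show ?thesis unfolding Q_def [symmetric] by auto
    qed
    have coord: "(\<Sum>f\<in>F. (a f - b f) * \<nu> f j) = 0" if "j \<in> {1..k}" for j
      using fun_cong [OF ab(4), of j] that by (simp add: \<phi>_def algebra_simps sum_subtractf)
    have "(\<Sum>f\<in>F. (a f - b f) * f) = (\<Sum>f\<in>F. (a f - b f) * (\<Sum>j=1..k. \<nu> f j * \<gamma> j))"
      using \<nu>(2) by (intro sum.cong) auto
    also have "\<dots> = (\<Sum>f\<in>F. \<Sum>j=1..k. (a f - b f) * \<nu> f j * \<gamma> j)"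
      by (simp add: sum_distrib_left mult.assoc)
    also have "\<dots> = (\<Sum>j=1..k. (\<Sum>f\<in>F. (a f - b f) * \<nu> f j) * \<gamma> j)"
      by (subst sum.swap) (simp add: sum_distrib_right)
    also have "\<dots> = 0" using coord by simp
    finally show "(\<Sum>f\<in>F. (a f - b f) * f) = 0" .
  qed
qed

text \<open>Relations are stated for indices rather than integers, and \<open>a\<close> need not be
  injective: one preimage is chosen for each of \<open>Suc k\<close> elements.\<close>

lemma card_mesh_le_of_no_relation:
  fixes a :: "'e \<Rightarrow> int"
  assumes mesh: "is_mesh k h M" and "h \<ge> 1"
    and indep: "\<And>F m. F \<subseteq> K \<Longrightarrow> finite F \<Longrightarrow> card F = Suc k \<Longrightarrow>
      (\<And>e. e \<in> F \<Longrightarrow> \<bar>m e\<bar> \<le> int ((2 * Suc k * h) ^ k)) \<Longrightarrow>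
      (\<Sum>e\<in>F. m e * a e) = 0 \<Longrightarrow> \<forall>e\<in>F. m e = 0"
  shows "card (a ` K \<inter> M) \<le> k"
proof (rule ccontr)
  assume "\<not> ?thesis"
  then have "Suc k \<le> card (a ` K \<inter> M)" by simp
  then obtain F' where F': "F' \<subseteq> a ` K \<inter> M" "card F' = Suc k" "finite F'"
    by (rule obtain_subset_with_card_n)
  then obtain F where F: "F \<subseteq> K" "inj_on a F" "a ` F = F'"
    by (metis le_inf_iff subset_image_inj)
  obtain m where m: "\<exists>f\<in>F'. m f \<noteq> 0" "\<And>f. f \<in> F' \<Longrightarrow> \<bar>m f\<bar> \<le> int ((2 * Suc k * h) ^ k)"
    "(\<Sum>f\<in>F'. m f * f) = 0"
    using mesh_relation [OF mesh \<open>h \<ge> 1\<close>, of F'] F' by blast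
  have "(\<Sum>e\<in>F. m (a e) * a e) = 0"
    using m(3) unfolding F(3) [symmetric] sum.reindex [OF F(2)] by simp
  moreover have "finite F" "card F = Suc k"
    using F'(2,3) F(2) unfolding F(3) [symmetric] by (simp_all add: finite_image_iff card_image)
  ultimately have "\<forall>e\<in>F. m (a e) = 0"
    using indep [of F "\<lambda>e. m (a e)"] F m(2) by blast
  then show False using m(1) F by blast
qed

lemma exists_lacunary:
  fixes \<tau> :: "nat \<Rightarrow> int"
  assumes "\<And>v. 0 \<le> \<tau> v"
  obtains g :: "nat \<Rightarrow> int" where "\<And>v. \<tau> v * (\<Sum>u<v. g u) < g v" "\<And>v. 0 < g v"
proof -
  \<comment> \<open>The recursion carries the partial sums, since \<open>g v\<close> depends on all
    earlier values.\<close>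
  define s where "s = rec_nat 0 (\<lambda>v x. x + (1 + \<tau> v * x))"
  define g where "g = (\<lambda>v. 1 + \<tau> v * s v)"
  have sum_g: "(\<Sum>u<v. g u) = s v" for v
    by (induction v) (simp_all add: s_def g_def)
  have "0 \<le> s v" for v
    using assms by (induction v) (simp_all add: s_def)
  then show thesis
    using that [of g] sum_g assms by (simp add: g_def add_pos_nonneg)
qed

section \<open>The set built from the graphs\<close>

text \<open>
  Block \<open>j\<close> is a bipartite graph with \<open>n j\<close> vertices on either side, whose edges come in
  \<open>C j\<close> perfect matchings: the edge \<open>(j, i, c)\<close> joins the left vertex \<open>i\<close> to the right vertex
  \<open>p j c i\<close>. Left and right vertices get the even and odd positions of the row \<open>j\<close> of the pairing
  function, and the edge becomes the integer \<open>g a + g b\<close>, where \<open>a\<close> and \<open>b\<close> are the positions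
  of its end points.
\<close>
locale lacunary_graphs =
  fixes C n X :: "nat \<Rightarrow> nat" and p :: "nat \<Rightarrow> nat \<Rightarrow> nat \<Rightarrow> nat"
    and g \<tau> :: "nat \<Rightarrow> int"
  assumes p_less: "\<And>j c i. c < C j \<Longrightarrow> i < n j \<Longrightarrow> p j c i < n j"
    and p_inv: "\<And>j c i. c < C j \<Longrightarrow> i < n j \<Longrightarrow> p j c (p j c i) = i"
    and free: "\<And>j cs i. set cs \<subseteq> {..<C j} \<Longrightarrow> cs \<noteq> [] \<Longrightarrow> distinct_adj cs \<Longrightarrow>
      length cs \<le> 2 * Suc (X j) \<Longrightarrow> i < n j \<Longrightarrow> fold (p j) cs i \<noteq> i"
    and mono_X: "mono X" and X_pos: "\<And>j. 1 \<le> X j"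
    and lac: "\<And>v. \<tau> v * (\<Sum>u<v. g u) < g v" and g_pos: "\<And>v. 0 < g v"
    and mono_\<tau>: "mono \<tau>"
    and \<tau>_ge: "\<And>j. int (2 * (2 * Suc (X (Suc j)) * X (Suc j)) ^ X (Suc j) * Suc (X (Suc j))) \<le> \<tau> j"
begin

definition edges :: "(nat \<times> nat \<times> nat) set" where
  "edges = {(j, i, c). i < n j \<and> c < C j}"

definition left_end :: "nat \<times> nat \<times> nat \<Rightarrow> nat" where
  "left_end = (\<lambda>(j, i, c). prod_encode (j, 2 * i))"

definition right_end :: "nat \<times> nat \<times> nat \<Rightarrow> nat" where
  "right_end = (\<lambda>(j, i, c). prod_encode (j, 2 * p j c i + 1))"

definition val :: "nat \<times> nat \<times> nat \<Rightarrow> int" where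
  "val e = g (left_end e) + g (right_end e)"

lemma left_end_neq_right_end: "left_end e \<noteq> right_end e'"
  by (cases e; cases e') (auto simp: left_end_def right_end_def prod_encode_eq, presburger)

text \<open>Grouped by vertices, the relation has coefficient \<open>L v + R v\<close> at
  \<open>g v\<close>, which explains the factor 2 in the bound on \<open>D\<close>. Lacunarity makes
  it vanish; as no vertex is both a left and a right end, \<open>L v\<close> and \<open>R v\<close>
  vanish separately.\<close>

lemma vertex_sums_zero:
  assumes "finite F" and block: "\<And>e. e \<in> F \<Longrightarrow> j0 \<le> fst e"
    and bound: "\<And>e. e \<in> F \<Longrightarrow> \<bar>m e\<bar> \<le> D" and D: "2 * D * int (card F) \<le> \<tau> j0"
    and rel: "(\<Sum>e\<in>F. m e * val e) = 0"
  shows "(\<Sum>e | e \<in> F \<and> left_end e = v. m e) = 0" "(\<Sum>e | e \<in> F \<and> right_end e = v. m e) = 0"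
proof -
  define V where "V = left_end ` F \<union> right_end ` F"
  define L where "L = (\<lambda>v. \<Sum>e | e \<in> F \<and> left_end e = v. m e)"
  define R where "R = (\<lambda>v. \<Sum>e | e \<in> F \<and> right_end e = v. m e)"
  have "finite V" using \<open>finite F\<close> by (simp add: V_def)
  have group: "(\<Sum>v\<in>V. (\<Sum>e | e \<in> F \<and> f e = v. m e) * g v) = (\<Sum>e\<in>F. m e * g (f e))"
    if "f ` F \<subseteq> V" for f
    unfolding sum.group [OF \<open>finite F\<close> \<open>finite V\<close> that, of "\<lambda>e. m e * g (f e)", symmetric]
    by (auto simp: sum_distrib_right intro!: sum.cong)
  have sum_le: "\<bar>\<Sum>e | e \<in> F \<and> P e. m e\<bar> \<le> D * int (card F)" for P
  proof -
    have "\<bar>\<Sum>e | e \<in> F \<and> P e. m e\<bar> \<le> (\<Sum>e | e \<in> F \<and> P e. \<bar>m e\<bar>)" by (rule sum_abs)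
    also have "\<dots> \<le> (\<Sum>e\<in>F. \<bar>m e\<bar>)" using \<open>finite F\<close> by (intro sum_mono2) auto
    also have "\<dots> \<le> (\<Sum>e\<in>F. D)" by (intro sum_mono bound)
    finally show ?thesis by (simp add: mult.commute)
  qed
  have zero: "L u + R u = 0" if "u \<in> V" for u
  proof (rule lacunary_relation_trivial [OF lac g_pos \<open>finite V\<close> _ _ that])
    fix u v assume "v \<in> V"
    \<comment> \<open>The pairing function is at least its first argument, so blocks from
      \<open>j0\<close> on only use positions from \<open>j0\<close> on.\<close>
    then have "j0 \<le> v"
      using block le_prod_encode_1 order.trans
      by (fastforce simp: V_def left_end_def right_end_def split: prod.splits)
    then have "\<tau> j0 \<le> \<tau> v" by (rule monoD [OF mono_\<tau>])
    then show "\<bar>L u + R u\<bar> \<le> \<tau> v"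
      using sum_le [of "\<lambda>e. left_end e = u"] sum_le [of "\<lambda>e. right_end e = u"] D
      unfolding L_def R_def by linarith
  next
    show "(\<Sum>v\<in>V. (L v + R v) * g v) = 0"
      using rel group [of left_end] group [of right_end]
      by (simp add: L_def R_def V_def val_def distrib_left distrib_right sum.distrib)
  qed
  have "L v = 0 \<and> R v = 0"
  proof (cases "v \<in> V")
    case True
    have "L v = 0 \<or> R v = 0"
    proof (cases "v \<in> left_end ` F")
      case True
      then have "{e. e \<in> F \<and> right_end e = v} = {}" using left_end_neq_right_end [THEN not_sym] by auto
      then show ?thesis unfolding R_def by (metis sum.empty)
    next
      case False
      then have "{e. e \<in> F \<and> left_end e = v} = {}" by auto
      then show ?thesis unfolding L_def by (metis sum.empty)
    qed
    then show ?thesis using zero [OF True] by auto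
  next
    case False
    then have "{e. e \<in> F \<and> left_end e = v} = {}" "{e. e \<in> F \<and> right_end e = v} = {}"
      by (auto simp: V_def)
    then show ?thesis unfolding L_def R_def by (metis sum.empty)
  qed
  then show "(\<Sum>e | e \<in> F \<and> left_end e = v. m e) = 0" "(\<Sum>e | e \<in> F \<and> right_end e = v. m e) = 0"
    by (simp_all add: L_def R_def)
qed

text \<open>Within a matching, each vertex sum over a left end has a single term.\<close>

lemma matching_relation_trivial:
  assumes F: "F \<subseteq> {e \<in> edges. fst e = j \<and> snd (snd e) = c}"
    and sums: "\<And>v. (\<Sum>e | e \<in> F \<and> left_end e = v. m e) = (0 :: int)" and "e \<in> F"
  shows "m e = 0"
proof -
  have "e' = e" if "e' \<in> F" "left_end e' = left_end e" for e'
  proof -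
    have "fst e' = fst e" "snd (snd e') = snd (snd e)" using F \<open>e \<in> F\<close> that(1) by auto
    then show ?thesis
      using that(2) by (simp add: left_end_def prod_encode_eq split_beta prod_eq_iff)
  qed
  then have "{e'. e' \<in> F \<and> left_end e' = left_end e} = {e}"
    using \<open>e \<in> F\<close> by blast
  then show ?thesis using sums [of "left_end e"] by simp
qed

text \<open>\<open>F\<close> may meet several blocks, but vertices of different blocks are distinct,
  so the sums can be treated within the block of \<open>e\<close>, which has no cycle short enough
  to fit into \<open>F\<close>.\<close>

lemma small_relation_trivial:
  assumes F: "F \<subseteq> edges" "finite F" and card: "\<And>e. e \<in> F \<Longrightarrow> card F \<le> Suc (X (fst e))"
    and left: "\<And>v. (\<Sum>e | e \<in> F \<and> left_end e = v. m e) = (0 :: int)"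
    and right: "\<And>v. (\<Sum>e | e \<in> F \<and> right_end e = v. m e) = (0 :: int)"
    and "e \<in> F"
  shows "m e = 0"
proof -
  obtain j i0 c0 where e: "e = (j, i0, c0)" by (cases e)
  have e_less: "i0 < n j" "c0 < C j" using F \<open>e \<in> F\<close> by (auto simp: e edges_def)
  have F_less: "i < n j" "c < C j" if "(j, i, c) \<in> F" for j i c
    using F that by (auto simp: edges_def)
  then have p_inv_F: "p j c (p j c i) = i" if "(j, i, c) \<in> F" for j i c
    using p_inv that by blast
  define \<mu> where "\<mu> = (\<lambda>i c. if (j, i, c) \<in> F then m (j, i, c) else 0)"
  have "\<mu> i0 c0 = 0"
  proof (rule edge_relation_trivial [where p = "p j" and n = "n j" and C = "C j" and r = "2 * Suc (X j)"])
    show "(\<Sum>c<C j. \<mu> i c) = 0" if "i < n j" for i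
    proof -
      have "(\<Sum>c<C j. \<mu> i c) = (\<Sum>c | c < C j \<and> (j, i, c) \<in> F. m (j, i, c))"
        by (rule sum.mono_neutral_cong_right) (auto simp: \<mu>_def)
      also have "\<dots> = (\<Sum>e | e \<in> F \<and> left_end e = prod_encode (j, 2 * i). m e)"
        using F by (intro sum.reindex_bij_witness [of _ "\<lambda>(j, i, c). c" "\<lambda>c. (j, i, c)"])
          (auto simp: left_end_def edges_def prod_encode_eq)
      finally show ?thesis using left by simp
    qed
    show "(\<Sum>c<C j. \<mu> (p j c i) c) = 0" if "i < n j" for i
    proof -
      have "(\<Sum>c<C j. \<mu> (p j c i) c) = (\<Sum>c | c < C j \<and> (j, p j c i, c) \<in> F. m (j, p j c i, c))"
        by (rule sum.mono_neutral_cong_right) (auto simp: \<mu>_def)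
      also have "\<dots> = (\<Sum>e | e \<in> F \<and> right_end e = prod_encode (j, 2 * i + 1). m e)"
        using that p_inv F_less p_inv_F
        by (intro sum.reindex_bij_witness [of _ "\<lambda>(j, i, c). c" "\<lambda>c. (j, p j c i, c)"])
          (auto simp: right_end_def prod_encode_eq)
      finally show ?thesis using right by simp
    qed
    have "card {(i, c). i < n j \<and> c < C j \<and> \<mu> i c \<noteq> 0} \<le> card F"
    proof (rule card_inj_on_le [OF _ _ \<open>finite F\<close>])
      show "inj_on (\<lambda>(i, c). (j, i, c)) {(i, c). i < n j \<and> c < C j \<and> \<mu> i c \<noteq> 0}"
        by (auto simp: inj_on_def)
    qed (auto simp: \<mu>_def split: if_splits)
    also have "\<dots> \<le> Suc (X j)" using card [OF \<open>e \<in> F\<close>] by (simp add: e)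
    finally show "2 * card {(i, c). i < n j \<and> c < C j \<and> \<mu> i c \<noteq> 0} \<le> 2 * Suc (X j)" by simp
  qed (use p_less p_inv free e_less in auto)
  then show ?thesis using \<open>e \<in> F\<close> by (simp add: \<mu>_def e)
qed

text \<open>\<open>\<tau> j\<close> is built from \<open>X (Suc j)\<close>, so lacunarity from row
  \<open>j\<close> on handles the relations of all meshes with \<open>k * h\<close> up to
  \<open>X (Suc j)\<close>, not merely up to \<open>X j\<close>.\<close>

lemma mesh_coefficient_bound:
  assumes "k * h \<le> X (Suc j)" "1 \<le> k" "1 \<le> h"
  shows "2 * int ((2 * Suc k * h) ^ k) * int (Suc k) \<le> \<tau> j"
proof -
  define Y where "Y = X (Suc j)"
  have "h \<le> k * h" "k \<le> k * h" using assms by simp_all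
  from this [THEN order.trans, OF assms(1)] have kh: "h \<le> Y" "k \<le> Y"
    unfolding Y_def by blast+
  have "(2 * Suc k * h) ^ k \<le> (2 * Suc Y * Y) ^ k"
    using kh by (intro power_mono mult_le_mono) auto
  also have "\<dots> \<le> (2 * Suc Y * Y) ^ Y"
    using kh assms by (intro power_increasing) auto
  finally have "2 * (2 * Suc k * h) ^ k * Suc k \<le> 2 * (2 * Suc Y * Y) ^ Y * Suc Y"
    using kh by (intro mult_le_mono) auto
  then have "int (2 * (2 * Suc k * h) ^ k * Suc k) \<le> \<tau> j"
    using \<tau>_ge [of j] unfolding Y_def by (metis of_nat_mono order.trans)
  then show ?thesis by (simp only: of_nat_mult of_nat_numeral)
qed

lemma card_matching_mesh_le:
  assumes mesh: "is_mesh k h M" and "1 \<le> k" "1 \<le> h" "k * h \<le> X (Suc j)"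
  shows "card (val ` {e \<in> edges. fst e = j \<and> snd (snd e) = c} \<inter> M) \<le> k"
proof (rule card_mesh_le_of_no_relation [OF mesh \<open>1 \<le> h\<close>])
  fix F m
  assume F: "F \<subseteq> {e \<in> edges. fst e = j \<and> snd (snd e) = c}" "finite F" "card F = Suc k"
    and m: "\<And>e. e \<in> F \<Longrightarrow> \<bar>m e\<bar> \<le> int ((2 * Suc k * h) ^ k)" "(\<Sum>e\<in>F. m e * val e) = 0"
  have "(\<Sum>e | e \<in> F \<and> left_end e = v. m e) = 0" for v
    using F m mesh_coefficient_bound [OF assms(4) assms(2,3)]
    by (intro vertex_sums_zero [of F j m "int ((2 * Suc k * h) ^ k)"]) auto
  then show "\<forall>e\<in>F. m e = 0" using matching_relation_trivial [OF F(1)] by blast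
qed

text \<open>Unlike for a matching, \<open>k * h\<close> must not exceed \<open>X j\<close>: then
  \<open>Suc k\<close> edges are too few to contain a cycle in any of the blocks concerned.\<close>

lemma card_tail_mesh_le:
  assumes mesh: "is_mesh k h M" and "1 \<le> k" "1 \<le> h" "k * h \<le> X j"
  shows "card (val ` {e \<in> edges. j \<le> fst e} \<inter> M) \<le> k"
proof (rule card_mesh_le_of_no_relation [OF mesh \<open>1 \<le> h\<close>])
  fix F m
  assume F: "F \<subseteq> {e \<in> edges. j \<le> fst e}" "finite F" "card F = Suc k"
    and m: "\<And>e. e \<in> F \<Longrightarrow> \<bar>m e\<bar> \<le> int ((2 * Suc k * h) ^ k)" "(\<Sum>e\<in>F. m e * val e) = 0"
  have "X j \<le> X (Suc j)" by (rule monoD [OF mono_X]) simp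
  then have kh: "k * h \<le> X (Suc j)" using assms(4) by simp
  have sums: "(\<Sum>e | e \<in> F \<and> left_end e = v. m e) = 0" "(\<Sum>e | e \<in> F \<and> right_end e = v. m e) = 0" for v
    using F m mesh_coefficient_bound [OF kh assms(2,3)]
    by (intro vertex_sums_zero [of F j m "int ((2 * Suc k * h) ^ k)"]; auto)+
  have "card F \<le> Suc (X (fst e))" if "e \<in> F" for e
  proof -
    have "k * 1 \<le> k * h" using assms by (intro mult_le_mono) auto
    also have "\<dots> \<le> X (fst e)"
      using assms(4) monoD [OF mono_X, of j "fst e"] F(1) that by auto
    finally show ?thesis using F(3) by simp
  qed
  then show "\<forall>e\<in>F. m e = 0"
    using small_relation_trivial [of F m] F sums by blast
qed

text \<open>Two edges with the same value would give a relation with coefficients 1 and -1 on two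
  edges.\<close>

lemma inj_on_val: "inj_on val {e \<in> edges. fst e = j}"
proof (rule inj_onI, rule ccontr)
  fix e e'
  assume e: "e \<in> {e \<in> edges. fst e = j}" "e' \<in> {e \<in> edges. fst e = j}" "val e = val e'" "e \<noteq> e'"
  define m where "m = (\<lambda>x. if x = e then 1 else - 1 :: int)"
  have card: "card {e, e'} = 2" using e(4) by simp
  have "X j \<le> X (Suc j)" by (rule monoD [OF mono_X]) simp
  then have "1 * 1 \<le> X (Suc j)" using X_pos [of j] by simp
  from mesh_coefficient_bound [OF this] have bound: "4 \<le> \<tau> j" by simp
  have rel: "(\<Sum>x\<in>{e, e'}. m x * val x) = 0" using e(3,4) by (simp add: m_def)
  have "j \<le> fst x" "\<bar>m x\<bar> \<le> 1" if "x \<in> {e, e'}" for x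
    using e that by (auto simp: m_def)
  moreover have "2 * 1 * int (card {e, e'}) \<le> \<tau> j" using bound card by simp
  ultimately have sums: "(\<Sum>x | x \<in> {e, e'} \<and> left_end x = v. m x) = 0"
    "(\<Sum>x | x \<in> {e, e'} \<and> right_end x = v. m x) = 0" for v
    using vertex_sums_zero [of "{e, e'}" j m 1 v] rel by blast+
  have "m e = 0"
  proof (rule small_relation_trivial [of "{e, e'}", OF _ _ _ sums])
    show "card {e, e'} \<le> Suc (X (fst x))" for x using X_pos [of "fst x"] card by simp
  qed (use e in auto)
  then show False by (simp add: m_def)
qed

lemma block_eq: "{e \<in> edges. fst e = j} = (\<lambda>(i, c). (j, i, c)) ` ({..<n j} \<times> {..<C j})"
  by (auto simp: edges_def)

lemma finite_block: "finite {e \<in> edges. fst e = j}"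
  unfolding block_eq by simp

lemma card_block: "card {e \<in> edges. fst e = j} = C j * n j"
  unfolding block_eq by (subst card_image) (auto simp: inj_on_def card_cartesian_product)

text \<open>All edges of the blocks before \<open>j\<close> are counted, block \<open>j\<close>
  contributes at most \<open>k\<close> for each of its \<open>C j\<close> matchings, and all later
  blocks together at most \<open>k\<close>.\<close>

lemma card_mesh_le:
  assumes mesh: "is_mesh k h M" and kh: "1 \<le> k" "1 \<le> h" "k * h \<le> X (Suc j)"
  shows "card (val ` edges \<inter> M) \<le> k * ((\<Sum>i<j. C i * n i) + C j + 1)"
proof -
  define A where "A = (\<Union>i<j. val ` {e \<in> edges. fst e = i})"
  define B where "B = (\<Union>c<C j. val ` {e \<in> edges. fst e = j \<and> snd (snd e) = c} \<inter> M)"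
  define T where "T = val ` {e \<in> edges. Suc j \<le> fst e} \<inter> M"
  have "val ` edges \<inter> M \<subseteq> A \<union> B \<union> T"
  proof
    fix x assume "x \<in> val ` edges \<inter> M"
    then obtain e where e: "e \<in> edges" "x = val e" "x \<in> M" by blast
    obtain j' i c where e': "e = (j', i, c)" by (cases e)
    then have "c < C j'" using e by (auto simp: edges_def)
    consider "j' < j" | "j' = j" | "Suc j \<le> j'" by linarith
    then show "x \<in> A \<union> B \<union> T"
    proof cases
      case 2
      then have "val e \<in> val ` {e \<in> edges. fst e = j \<and> snd (snd e) = c}"
        using e e' by (intro imageI) simp
      then show ?thesis using e \<open>c < C j'\<close> 2 by (auto simp: B_def)
    qed (use e e' in \<open>auto simp: A_def T_def\<close>)
  qed
  moreover have "finite (A \<union> B \<union> T)"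
    using finite_mesh [OF mesh] finite_block by (auto simp: A_def B_def T_def)
  ultimately have "card (val ` edges \<inter> M) \<le> card (A \<union> B \<union> T)" by (intro card_mono)
  also have "\<dots> \<le> card A + card B + card T"
    by (meson add_le_mono1 card_Un_le order.trans)
  also have "card A \<le> (\<Sum>i<j. C i * n i)"
  proof -
    have "card A \<le> (\<Sum>i<j. card (val ` {e \<in> edges. fst e = i}))"
      unfolding A_def by (rule card_UN_le) simp
    also have "\<dots> \<le> (\<Sum>i<j. C i * n i)"
      by (intro sum_mono order.trans [OF card_image_le [OF finite_block]]) (simp add: card_block)
    finally show ?thesis .
  qed
  also have "card B \<le> C j * k"
  proof -
    have "card B \<le> (\<Sum>c<C j. card (val ` {e \<in> edges. fst e = j \<and> snd (snd e) = c} \<inter> M))"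
      unfolding B_def by (rule card_UN_le) simp
    also have "\<dots> \<le> (\<Sum>c<C j. k)"
      by (intro sum_mono card_matching_mesh_le [OF mesh kh])
    finally show ?thesis by simp
  qed
  also have "card T \<le> k" unfolding T_def by (rule card_tail_mesh_le [OF mesh kh])
  also have "(\<Sum>i<j. C i * n i) \<le> k * (\<Sum>i<j. C i * n i)" using kh by simp
  finally show ?thesis by (simp add: algebra_simps)
qed

text \<open>For each \<open>t\<close> the character at \<open>val e\<close> is a product of a factor
  for the left end and one for the right end, so the polynomial with coefficients
  \<open>\<epsilon>\<close> is a bilinear form with small bound.\<close>

lemma not_S_Sidon:
  fixes S :: real
  assumes S: "S \<ge> 1" and C: "128 * S\<^sup>2 \<le> C j" and n: "0 < n j"
  shows "\<not> S_Sidon S (val ` edges)"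
proof
  assume Sidon: "S_Sidon S (val ` edges)"
  define E where "E = {e \<in> edges. fst e = j}"
  \<comment> \<open>Chosen so that \<open>S * (2 * \<delta>) = 1 / 2\<close>; then
    \<open>128 * S\<^sup>2 \<le> C j\<close> gives
    \<open>2 \<le> \<delta>\<^sup>2 / 4 * C j\<close>, which beats \<open>2 * ln 2\<close>.\<close>
  define \<delta> where "\<delta> = 1 / (4 * S)"
  define l where "l = (\<lambda>(j :: nat, i :: nat, c :: nat). i)"
  define q where "q = (\<lambda>(j, i, c). p j c i)"
  have "finite E" by (simp add: E_def finite_block)
  have "0 < 128 * S\<^sup>2" using S by simp
  also note C
  finally have "0 < C j" by simp
  then have "0 < card E" using n by (simp add: E_def card_block)
  have size: "real (card {..<n j} + card {..<n j}) * ln 2 < \<delta>\<^sup>2 / 4 * real (card E)"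
  proof -
    have "ln 2 < (1 :: real)" using ln_2_less_1 by simp
    then have "2 * ln 2 < (2 :: real)" by simp
    also have "2 \<le> \<delta>\<^sup>2 / 4 * C j"
      using C S by (simp add: \<delta>_def power_divide power_mult_distrib field_simps)
    finally have "real (n j) * (2 * ln 2) < real (n j) * (\<delta>\<^sup>2 / 4 * C j)"
      using n by simp
    then show ?thesis by (simp add: E_def card_block algebra_simps)
  qed
  have ends: "l ` E \<subseteq> {..<n j}" "q ` E \<subseteq> {..<n j}"
    using p_less by (auto simp: E_def edges_def l_def q_def)
  have \<delta>: "0 < \<delta>" "\<delta> \<le> 1" using S by (simp_all add: \<delta>_def)
  obtain \<epsilon> :: "nat \<times> nat \<times> nat \<Rightarrow> real" where \<epsilon>: "\<forall>e\<in>E. \<bar>\<epsilon> e\<bar> = (1 :: real)"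
    and form: "\<forall>(x :: nat \<Rightarrow> complex) (y :: nat \<Rightarrow> complex). (\<forall>a. cmod (x a) \<le> 1) \<longrightarrow> (\<forall>b. cmod (y b) \<le> 1) \<longrightarrow>
       cmod (\<Sum>e\<in>E. \<epsilon> e * x (l e) * y (q e)) \<le> 2 * \<delta> * card E"
    using exists_signs_small_bilinear_form
      [OF \<open>finite E\<close> finite_lessThan finite_lessThan ends \<delta> size] by blast
  define a where "a = (\<lambda>z. complex_of_real (\<epsilon> (inv_into E val z)))"
  have inj: "inj_on val E" unfolding E_def by (rule inj_on_val)
  then have a_val: "a (val e) = \<epsilon> e" if "e \<in> E" for e using that by (simp add: a_def)
  have poly_le: "cmod (trig_poly (val ` E) a t) \<le> 2 * \<delta> * card E" for t
  proof -
    define x where "x = (\<lambda>i. exp (\<i> * of_int (g (prod_encode (j, 2 * i))) * of_real t))"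
    define y where "y = (\<lambda>i. exp (\<i> * of_int (g (prod_encode (j, 2 * i + 1))) * of_real t))"
    have unit: "cmod (exp (\<i> * of_int z * of_real t)) = 1" for z
      using norm_exp_i_times [of "of_int z * t"] by (simp add: mult.assoc)
    have "trig_poly (val ` E) a t = (\<Sum>e\<in>E. \<epsilon> e * exp (\<i> * of_int (val e) * of_real t))"
      unfolding trig_poly_def by (simp add: sum.reindex [OF inj] a_val)
    also have "\<dots> = (\<Sum>e\<in>E. \<epsilon> e * x (l e) * y (q e))"
      by (intro sum.cong)
        (auto simp: E_def edges_def val_def left_end_def right_end_def x_def y_def l_def q_def
          algebra_simps simp flip: exp_add)
    finally show ?thesis using form [rule_format, of x y] unit by (simp add: x_def y_def)
  qed
  have "real (card E) = (\<Sum>z\<in>val ` E. cmod (a z))"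
    using \<epsilon> by (simp add: sum.reindex [OF inj] a_val)
  also have "\<dots> \<le> S * (SUP t. cmod (trig_poly (val ` E) a t))"
    using Sidon \<open>finite E\<close> unfolding S_Sidon_def E_def by blast
  also have "\<dots> \<le> S * (2 * \<delta> * card E)"
    using S poly_le by (intro mult_left_mono cSUP_least) auto
  also have "\<dots> = card E / 2" using S by (simp add: \<delta>_def)
  finally show False using \<open>0 < card E\<close> by simp
qed

end

section \<open>Choice of the parameters and conclusion\<close>

theorem mainTheorem3:
  fixes w :: "real \<Rightarrow> real"
  assumes "mono_on {1..} w"
    and "\<And>x. x \<ge> 1 \<Longrightarrow> w x \<ge> 1"
    and "filterlim w at_top at_top"
  shows "\<exists>\<Lambda> :: int set. \<not> Sidon \<Lambda> \<and>
           (\<forall>(h::nat) (k::nat) M. h \<ge> 1 \<and> k \<ge> 1 \<and> is_mesh k h M \<longrightarrow>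
              real (card (\<Lambda> \<inter> M)) \<le> real k * w (real (k * h)))"
proof -
  define good where "good = (\<lambda>(C :: nat) (r :: nat) (n :: nat) p. 0 < n \<and> (\<forall>c i. c < C \<longrightarrow> i < n \<longrightarrow> p c i < n) \<and>
      (\<forall>c i. c < C \<longrightarrow> i < n \<longrightarrow> p c (p c i) = i) \<and>
      (\<forall>cs i. set cs \<subseteq> {..<C} \<longrightarrow> cs \<noteq> [] \<longrightarrow> distinct_adj cs \<longrightarrow> length cs \<le> r \<longrightarrow>
         i < n \<longrightarrow> fold p cs i \<noteq> (i :: nat)))"
  have "\<exists>n p. good C r n p" for C r :: nat
  proof -
    obtain n p where "good C r n p"
      unfolding good_def using free_involutions_exist [of C r] by metis
    then show ?thesis by blast
  qed
  then obtain N P where "\<And>C r. good C r (N C r) (P C r)" by metis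
  then have N_pos: "\<And>C r. 0 < N C r"
    and P_less: "\<And>C r c i. c < C \<Longrightarrow> i < N C r \<Longrightarrow> P C r c i < N C r"
    and P_inv: "\<And>C r c i. c < C \<Longrightarrow> i < N C r \<Longrightarrow> P C r c (P C r c i) = i"
    and P_free: "\<And>C r cs i. set cs \<subseteq> {..<C} \<Longrightarrow> cs \<noteq> [] \<Longrightarrow> distinct_adj cs \<Longrightarrow> length cs \<le> r \<Longrightarrow>
         i < N C r \<Longrightarrow> fold (P C r) cs i \<noteq> i"
    unfolding good_def by blast+
  \<comment> \<open>Taking the least such \<open>x\<close> makes \<open>xs\<close> monotone.\<close>
  define xs where "xs = (\<lambda>y :: nat. LEAST x :: nat. y \<le> x \<and> real y \<le> w (real x))"
  have xs: "y \<le> xs y \<and> real y \<le> w (real (xs y))" for y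
  proof -
    have "eventually (\<lambda>x. real y \<le> w x) at_top"
      using assms(3) by (simp add: filterlim_at_top)
    then obtain b where "\<And>x. b \<le> x \<Longrightarrow> real y \<le> w x" by (auto simp: eventually_at_top_linorder)
    moreover obtain x0 :: nat where "b \<le> x0" using real_arch_simple by blast
    ultimately have "y \<le> max x0 y \<and> real y \<le> w (real (max x0 y))" by simp
    then show ?thesis unfolding xs_def by (rule LeastI)
  qed
  have xs_mono: "xs y \<le> xs z" if "y \<le> z" for y z
  proof -
    have "y \<le> xs z \<and> real y \<le> w (real (xs z))" using xs [of z] that by simp
    then show ?thesis unfolding xs_def [THEN fun_cong, of y] by (rule Least_le)
  qed
  \<comment> \<open>\<open>T j\<close> is the number of edges in the blocks before \<open>j\<close>,
    and block \<open>j\<close> has \<open>Suc j\<close> matchings. \<open>X j\<close> depends only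
    on \<open>T j\<close> and \<open>j\<close>, so a recursion for \<open>T\<close> alone suffices.
    It ensures that \<open>w (X j)\<close> is at least \<open>T j + Suc j + 1\<close>, the factor in
    \<open>card_mesh_le\<close>.\<close>
  define T where "T = rec_nat 0 (\<lambda>j s. s + Suc j * N (Suc j) (2 * Suc (xs (s + Suc j + 1))))"
  define X where "X = (\<lambda>j. xs (T j + Suc j + 1))"
  define n where "n = (\<lambda>j. N (Suc j) (2 * Suc (X j)))"
  define p where "p = (\<lambda>j. P (Suc j) (2 * Suc (X j)))"
  define \<tau> where "\<tau> = (\<lambda>j. int (2 * (2 * Suc (X (Suc j)) * X (Suc j)) ^ X (Suc j) * Suc (X (Suc j))))"
  have T_sum: "(\<Sum>i<j. Suc i * n i) = T j" for j
    by (induction j) (simp_all add: T_def n_def X_def)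
  have X_ge: "T j + Suc j + 1 \<le> X j" "real (T j + Suc j + 1) \<le> w (real (X j))" for j
    using xs unfolding X_def by blast+
  have "T j \<le> T (Suc j)" for j by (simp add: T_def)
  then have mono_X: "mono X"
    unfolding X_def by (intro mono_iff_le_Suc [THEN iffD2] allI xs_mono) (simp add: le_SucI)
  have mono_\<tau>: "mono \<tau>"
  proof (rule monoI)
    fix i j :: nat assume "i \<le> j"
    then have le: "X (Suc i) \<le> X (Suc j)" by (intro monoD [OF mono_X]) simp
    have "1 \<le> X (Suc j)" using X_ge(1) [of "Suc j"] by simp
    then have "(2 * Suc (X (Suc i)) * X (Suc i)) ^ X (Suc i) \<le> (2 * Suc (X (Suc j)) * X (Suc j)) ^ X (Suc j)"
      using le by (intro order.trans [OF power_mono power_increasing] mult_le_mono) auto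
    then show "\<tau> i \<le> \<tau> j"
      unfolding \<tau>_def of_nat_le_iff using le by (intro mult_le_mono) auto
  qed
  obtain g :: "nat \<Rightarrow> int" where g: "\<And>v. \<tau> v * (\<Sum>u<v. g u) < g v" "\<And>v. 0 < g v"
    using exists_lacunary [of \<tau>] by (auto simp: \<tau>_def)
  interpret lacunary_graphs Suc n X p g \<tau>
  proof
    show "1 \<le> X j" for j using X_ge(1) [of j] by simp
  qed (use P_less P_inv P_free mono_X mono_\<tau> g in \<open>auto simp: n_def p_def \<tau>_def\<close>)
  have not_Sidon: "\<not> Sidon (val ` edges)"
  proof
    assume "Sidon (val ` edges)"
    then obtain S where S: "S \<ge> 1" "S_Sidon S (val ` edges)" unfolding Sidon_def by blast
    obtain j :: nat where "128 * S\<^sup>2 \<le> j" using real_arch_simple by blast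
    then show False using not_S_Sidon [of S j] S N_pos by (auto simp: n_def)
  qed
  have mesh_le: "real (card (val ` edges \<inter> M)) \<le> real k * w (real (k * h))"
    if hk: "h \<ge> 1" "k \<ge> 1" and mesh: "is_mesh k h M" for h k :: nat and M
  proof -
    have kh: "1 \<le> k * h" using hk by simp
    show ?thesis
    \<comment> \<open>Here the whole set is the tail from block 0, and \<open>w\<close> being at
      least 1 is enough.\<close>
    proof (cases "k * h \<le> X 0")
      case True
      then have "card (val ` edges \<inter> M) \<le> k"
        using card_tail_mesh_le [OF mesh hk(2,1), of 0] by simp
      then have "real (card (val ` edges \<inter> M)) \<le> real k * 1" by simp
      also have "\<dots> \<le> real k * w (real (k * h))"
        using assms(2) [of "real (k * h)"] kh by (intro mult_left_mono) linarith+
      finally show ?thesis .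
    next
      case False
      \<comment> \<open>By minimality \<open>X j < k * h \<le> X (Suc j)\<close> for
        \<open>i = Suc j\<close>: the upper bound allows \<open>card_mesh_le\<close>, the lower one
        the monotonicity of \<open>w\<close>.\<close>
      define i where "i = (LEAST i. k * h \<le> X i)"
      have "k * h \<le> X (k * h)" using X_ge(1) [of "k * h"] by simp
      then have i: "k * h \<le> X i" unfolding i_def by (rule LeastI)
      then obtain j where j: "i = Suc j" using False by (cases i) auto
      then have "X j < k * h" unfolding i_def by (metis lessI not_le not_less_Least)
      have "real (card (val ` edges \<inter> M)) \<le> real (k * (T j + Suc j + 1))"
        using card_mesh_le [OF mesh hk(2,1), of j] i unfolding j T_sum by (simp only: of_nat_le_iff)
      also have "\<dots> = real k * real (T j + Suc j + 1)" by (simp only: of_nat_mult)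
      also have "\<dots> \<le> real k * w (real (X j))" by (intro mult_left_mono X_ge) simp
      also have "\<dots> \<le> real k * w (real (k * h))"
      proof (intro mult_left_mono mono_onD [OF assms(1)])
        have "1 \<le> X j" using X_ge(1) [of j] by simp
        then show "real (X j) \<in> {1..}" by simp
        show "real (k * h) \<in> {1..}" using kh by (simp del: of_nat_mult)
        show "real (X j) \<le> real (k * h)" using \<open>X j < k * h\<close> by (simp del: of_nat_mult)
      qed simp
      finally show ?thesis .
    qed
  qed
  show ?thesis using not_Sidon mesh_le by (intro exI [of _ "val ` edges"]) blast
qed

end
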